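(* Every path-connected pre-$\Delta$-group is transfinitely $\pi_1$-commutative at all of its points.
   Context: A pre-$\Delta$-monoid is a space $M$ with an associative operation $\ast$ with identity $e$ such that for any continuous paths $\alpha,\beta:[0,1]\to M$, the pointwise product $t\mapsto\alpha(t)\ast\beta(t)$ is continuous; a pre-$\Delta$-group is a pre-$\Delta$-monoid whose underlying monoid is a group (no continuity of inversion is assumed). Let $\mathbb{H}=\bigcup_nC_n$ be the Hawaiian earring ($C_n\subset\mathbb{R}^2$ the circle of radius $1/n$ centered at $(1/n,0)$, basepoint $b_0=(0,0)$), $\ell_n$ the counterclockwise loop on $C_n$. A sequence of loops $\alpha_n\in\Omega(X,x)$ is a null-sequence if every neighborhood of $x$ contains all but finitely many $\mathrm{Im}(\alpha_n)$; then there is a unique map $f:(\mathbb{H},b_0)\to(X,x)$ with $f\circ\ell_n=\alpha_n$. With $\mathcal{C}\subseteq[0,1]$ the middle-thirds Cantor set and $[0,1]\setminus\mathcal{C}=\bigcup_{n\ge1}\bigcup_{k=1}^{2^{n-1}}I_n^k$ (open intervals of length $3^{-n}$, left to right for fixed $n$), $\ell_\tau$ is the loop with $\ell_\tau(\mathcal{C})=b_0$ equal to $\ell_{2^{n-1}+k-1}$ on $\overline{I_n^k}$, and $\prod_\tau\alpha_n:=f\circ\ell_\tau$. $X$ is transfinitely $\pi_1$-commutative at $x$ if $[\prod_\tau\alpha_n]=[\prod_\tau\alpha_{\phi(n)}]$ for every null-sequence and every bijection $\phi:\mathbb{N}\to\mathbb{N}$. *)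

theory Defs
  imports "HOL-Analysis.Analysis"
begin

definition pre_delta_monoid :: "('a::topological_space \<Rightarrow> 'a \<Rightarrow> 'a) \<Rightarrow> 'a \<Rightarrow> bool" where
  "pre_delta_monoid mul e \<longleftrightarrow>
     (\<forall>x y z. mul (mul x y) z = mul x (mul y z)) \<and>
     (\<forall>x. mul e x = x \<and> mul x e = x) \<and>
     (\<forall>\<alpha> \<beta>. path \<alpha> \<longrightarrow> path \<beta> \<longrightarrow> path (\<lambda>t. mul (\<alpha> t) (\<beta> t)))"

definition pre_delta_group :: "('a::topological_space \<Rightarrow> 'a \<Rightarrow> 'a) \<Rightarrow> 'a \<Rightarrow> bool" where
  "pre_delta_group mul e \<longleftrightarrow> pre_delta_monoid mul e \<and> (\<forall>x. \<exists>y. mul x y = e \<and> mul y x = e)"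

text \<open>Paper indexing: n \<ge> 1. ell n is the counterclockwise loop on the circle C_n of radius 1/n
  centred at (1/n,0), based at the origin.\<close>
definition hloop :: "nat \<Rightarrow> real \<Rightarrow> complex" where
  "hloop n t = complex_of_real (1 / real n) * (1 - exp (2 * pi * \<i> * complex_of_real t))"

definition hawaiian :: "complex set" where
  "hawaiian = (\<Union>n\<in>{1..}. path_image (hloop n))"

definition based_loop :: "'a::topological_space \<Rightarrow> (real \<Rightarrow> 'a) \<Rightarrow> bool" where
  "based_loop x g \<longleftrightarrow> path g \<and> pathstart g = x \<and> pathfinish g = x"

text \<open>Sequences are indexed by nat; only indices n \<ge> 1 are used (paper: n \<in> {1,2,...}).
  We index sequences from 0 and let alpha (n-1) play the role of the paper's alpha_n.\<close>
definition null_sequence :: "'a::topological_space \<Rightarrow> (nat \<Rightarrow> real \<Rightarrow> 'a) \<Rightarrow> bool" where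
  "null_sequence x \<alpha> \<longleftrightarrow> (\<forall>n. based_loop x (\<alpha> n)) \<and>
     (\<forall>U. open U \<longrightarrow> x \<in> U \<longrightarrow> (\<forall>\<^sub>F n in sequentially. path_image (\<alpha> n) \<subseteq> U))"

text \<open>The induced map f : (H, 0) \<rightarrow> (X, x) with f \<circ> ell_n = alpha_n (paper index n \<ge> 1 corresponds
  to alpha (n - 1)).  Outside H its value is irrelevant (set to x).\<close>
definition induced_map :: "'a \<Rightarrow> (nat \<Rightarrow> real \<Rightarrow> 'a) \<Rightarrow> complex \<Rightarrow> 'a" where
  "induced_map x \<alpha> z =
     (if z \<in> hawaiian \<and> z \<noteq> 0
      then (let (n, t) = (SOME (n, t). 1 \<le> n \<and> t \<in> {0..1} \<and> hloop n t = z) in \<alpha> (n - 1) t)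
      else x)"

text \<open>Left endpoint of the open interval I_n^k (n \<ge> 1, 1 \<le> k \<le> 2^(n-1)), of length 3^-n, the
  k-th from the left among those of length 3^-n removed in forming the Cantor set: the binary digits
  of k-1 (n-1 digits, most significant first) give the ternary digits 0/2 of the left endpoint.\<close>
definition cantor_left :: "nat \<Rightarrow> nat \<Rightarrow> real" where
  "cantor_left n k =
     (\<Sum>j = 1..n - 1. 2 * real (((k - 1) div 2 ^ (n - 1 - j)) mod 2) / 3 ^ j) + 1 / 3 ^ n"

definition cantor_gap :: "nat \<Rightarrow> nat \<Rightarrow> real set" where
  "cantor_gap n k = {cantor_left n k <..< cantor_left n k + 1 / 3 ^ n}"

definition gap_index :: "nat \<Rightarrow> nat \<Rightarrow> bool" where
  "gap_index n k \<longleftrightarrow> 1 \<le> n \<and> 1 \<le> k \<and> k \<le> 2 ^ (n - 1)"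

definition ell_tau :: "real \<Rightarrow> complex" where
  "ell_tau t =
     (if \<exists>n k. gap_index n k \<and> t \<in> closure (cantor_gap n k)
      then (let (n, k) = (SOME (n, k). gap_index n k \<and> t \<in> closure (cantor_gap n k))
            in hloop (2 ^ (n - 1) + k - 1) ((t - cantor_left n k) * 3 ^ n))
      else 0)"

definition prod_tau :: "'a \<Rightarrow> (nat \<Rightarrow> real \<Rightarrow> 'a) \<Rightarrow> real \<Rightarrow> 'a" where
  "prod_tau x \<alpha> = induced_map x \<alpha> \<circ> ell_tau"

definition transfinitely_pi1_commutative :: "'a::topological_space \<Rightarrow> bool" where
  "transfinitely_pi1_commutative x \<longleftrightarrow>
     (\<forall>\<alpha> (\<phi>::nat \<Rightarrow> nat). null_sequence x \<alpha> \<longrightarrow> bij \<phi> \<longrightarrow>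
        homotopic_paths UNIV (prod_tau x \<alpha>) (prod_tau x (\<lambda>n. \<alpha> (\<phi> n))))"

end

theory Submission
  imports Defs
begin

text \<open>
  Replacing the product by \<open>(a, b) \<mapsto> a x\<^sup>-\<^sup>1 b\<close> makes \<open>x\<close> the identity, so it suffices to treat the
  identity \<open>e\<close> of a pre-\<open>\<Delta>\<close>-monoid. There the pointwise product of two loops is homotopic to
  their concatenation, because products of continuous maps on the square are again continuous.

  Let \<open>p\<^sub>n\<close> be the product over the Cantor gaps of the loops \<open>\<alpha>\<^sub>k\<close> with \<open>k \<ge> n\<close>, let \<open>a\<^sub>n\<close> be the
  single loop \<open>\<alpha>\<^sub>n\<close> placed in its gap, and let \<open>W\<close> denote the product of a null-sequence in order
  type \<open>\<omega>\<close>. Pointwise \<open>p\<^sub>n = a\<^sub>n p\<^sub>n\<^sub>+\<^sub>1\<close>, hence \<open>W(p\<^sub>n) = W(a\<^sub>n) W(p\<^sub>n\<^sub>+\<^sub>1)\<close>, while splitting off the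
  first factor gives \<open>W(p\<^sub>n) = p\<^sub>0 \<cdot> W(p\<^sub>n\<^sub>+\<^sub>1)\<close>. Cancelling \<open>W(p\<^sub>n\<^sub>+\<^sub>1)\<close> in the fundamental group shows
  that \<open>p\<^sub>0\<close> is homotopic to \<open>W(a\<^sub>n)\<close>, which is homotopic to \<open>W(\<alpha>\<^sub>n)\<close>. Nothing in this argument
  depends on which gap carries which loop.
\<close>

section \<open>Products of null-sequences of loops over disjoint intervals\<close>

text \<open>Meant for families in which at most one \<open>f n t\<close> differs from
  \<open>x\<close> at each \<open>t\<close>; the choice made by \<open>SOME\<close> is then
  forced.\<close>

definition glue :: "'a \<Rightarrow> (nat \<Rightarrow> 'b \<Rightarrow> 'a) \<Rightarrow> 'b \<Rightarrow> 'a" where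
  "glue x f t = (if \<exists>n. f n t \<noteq> x then f (SOME n. f n t \<noteq> x) t else x)"

text \<open>Since \<open>f n t\<close> may itself be \<open>x\<close>, an index obtained from a
  separation hypothesis can be used without asking whether any factor is active at
  \<open>t\<close>.\<close>

lemma glue_eq:
  assumes "\<And>m. m \<noteq> n \<Longrightarrow> f m t = x"
  shows "glue x f t = f n t"
proof (cases "f n t = x")
  case True
  then show ?thesis using assms unfolding glue_def by metis
next
  case False
  then have "(SOME m. f m t \<noteq> x) = n" using assms by (intro some_equality) blast+
  then show ?thesis using False unfolding glue_def by auto
qed

lemma glue_in:
  assumes "x \<in> U" "\<And>n. f n t \<in> U"
  shows "glue x f t \<in> U"
  using assms unfolding glue_def by auto

text \<open>The preimage of an open set containing \<open>x\<close> is an intersection of the preimages under the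
  \<open>f n\<close>, finite by nullity; the preimage of any other open set is their union.\<close>
lemma continuous_on_glue:
  fixes f :: "nat \<Rightarrow> 'b::topological_space \<Rightarrow> 'a::topological_space"
  assumes cont: "\<And>n. continuous_on S (f n)"
    and sep: "\<And>t. t \<in> S \<Longrightarrow> \<exists>n. \<forall>m. m \<noteq> n \<longrightarrow> f m t = x"
    and null: "\<And>U. open U \<Longrightarrow> x \<in> U \<Longrightarrow> \<forall>\<^sub>F n in sequentially. f n ` S \<subseteq> U"
  shows "continuous_on S (glue x f)"
  unfolding continuous_on_open_invariant
proof (intro allI impI)
  fix B :: "'a set"
  assume B: "open B"
  have "\<forall>n. \<exists>A. open A \<and> A \<inter> S = f n -` B \<inter> S"
    using cont B unfolding continuous_on_open_invariant by blast
  then obtain A where A: "\<And>n. open (A n)" "\<And>n. A n \<inter> S = f n -` B \<inter> S"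
    by metis
  show "\<exists>A. open A \<and> A \<inter> S = glue x f -` B \<inter> S"
  proof (cases "x \<in> B")
    case True
    define N where "N = {n. \<not> f n ` S \<subseteq> B}"
    have "finite N"
      using null[OF B True] unfolding N_def by (simp add: eventually_cofinite flip: cofinite_eq_sequentially)
    then have "open (\<Inter>n\<in>N. A n)" using A(1) by auto
    moreover have "(\<Inter>n\<in>N. A n) \<inter> S = glue x f -` B \<inter> S"
    proof (intro set_eqI iffI)
      fix t assume t: "t \<in> (\<Inter>n\<in>N. A n) \<inter> S"
      have "f n t \<in> B" for n
      proof (cases "n \<in> N")
        case True
        then show ?thesis using t A(2)[of n] by blast
      next
        case False
        then show ?thesis using t by (auto simp: N_def)
      qed
      then show "t \<in> glue x f -` B \<inter> S" using glue_in[OF True, of f t] t by auto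
    next
      fix t assume t: "t \<in> glue x f -` B \<inter> S"
      obtain n where n: "\<And>m. m \<noteq> n \<Longrightarrow> f m t = x" using sep t by blast
      then have "f n t \<in> B" using glue_eq[of n f t x] t by auto
      then have "f m t \<in> B" for m using n True by (cases "m = n") auto
      then show "t \<in> (\<Inter>n\<in>N. A n) \<inter> S" using A(2) t by blast
    qed
    ultimately show ?thesis by blast
  next
    case False
    have "open (\<Union>n. A n)" using A(1) by auto
    moreover have "(\<Union>n. A n) \<inter> S = glue x f -` B \<inter> S"
    proof (intro set_eqI iffI)
      fix t assume t: "t \<in> (\<Union>n. A n) \<inter> S"
      then obtain k where k: "f k t \<in> B" using A(2) by blast
      obtain n where n: "\<And>m. m \<noteq> n \<Longrightarrow> f m t = x" using sep t by blast
      have "k = n" using n k False by metis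
      then show "t \<in> glue x f -` B \<inter> S" using glue_eq[of n f t x] n t k by auto
    next
      fix t assume t: "t \<in> glue x f -` B \<inter> S"
      obtain n where n: "\<And>m. m \<noteq> n \<Longrightarrow> f m t = x" using sep t by blast
      then have "f n t \<in> B" using glue_eq[of n f t x] t by auto
      then show "t \<in> (\<Union>n. A n) \<inter> S" using A(2) t by blast
    qed
    ultimately show ?thesis by blast
  qed
qed

text \<open>The model case: \<open>r n\<close> collapses the complement of the \<open>n\<close>-th interval of a disjoint family
  in \<open>{0..1}\<close> and maps the interval itself affinely onto \<open>{0..1}\<close>.\<close>
definition collapse_family :: "(nat \<Rightarrow> real \<Rightarrow> real) \<Rightarrow> bool" where
  "collapse_family r \<longleftrightarrow>
     (\<forall>n. continuous_on {0..1} (r n) \<and> r n ` {0..1} \<subseteq> {0..1} \<and> r n 0 = 0 \<and> r n 1 = 1) \<and>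
     (\<forall>t\<in>{0..1}. \<exists>n. \<forall>m. m \<noteq> n \<longrightarrow> r m t \<in> {0, 1})"

lemma collapse_familyD:
  assumes "collapse_family r"
  shows "continuous_on {0..1} (r n)" "t \<in> {0..1} \<Longrightarrow> r n t \<in> {0..1}" "r n 0 = 0" "r n 1 = 1"
    "t \<in> {0..1} \<Longrightarrow> \<exists>n. \<forall>m. m \<noteq> n \<longrightarrow> r m t \<in> {0, 1}"
  using assms unfolding collapse_family_def by blast+

text \<open>Order and position of the factors sit entirely in \<open>r\<close>, so one sequence
  \<open>\<alpha>\<close> can be multiplied in different orders.\<close>

definition loop_product :: "'a \<Rightarrow> (nat \<Rightarrow> real \<Rightarrow> real) \<Rightarrow> (nat \<Rightarrow> real \<Rightarrow> 'a) \<Rightarrow> real \<Rightarrow> 'a" where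
  "loop_product x r \<alpha> = glue x (\<lambda>n t. \<alpha> n (r n t))"

lemma based_loopD:
  assumes "based_loop x g"
  shows "continuous_on {0..1} g" "g 0 = x" "g 1 = x"
  using assms unfolding based_loop_def by (auto simp: path_def pathstart_def pathfinish_def)

lemma based_loop_01: "based_loop x g \<Longrightarrow> t \<in> {0, 1} \<Longrightarrow> g t = x"
  using based_loopD(2,3) by blast

lemma null_sequenceD:
  assumes "null_sequence x \<alpha>"
  shows "based_loop x (\<alpha> n)" "open U \<Longrightarrow> x \<in> U \<Longrightarrow> \<forall>\<^sub>F n in sequentially. \<alpha> n ` {0..1} \<subseteq> U"
  using assms unfolding null_sequence_def path_image_def by auto

text \<open>The domain is general because it is the unit interval for a product of loops and the
  unit square for a homotopy of products. Parameters 0 and 1 both give \<open>x\<close>, so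
  separation of the \<open>R m\<close> separates the loops.\<close>

lemma continuous_on_glue_null_sequence:
  fixes S :: "'b::topological_space set"
  assumes \<alpha>: "null_sequence x \<alpha>"
    and R: "\<And>n. continuous_on S (R n)" "\<And>n. R n ` S \<subseteq> {0..1}"
    and sep: "\<And>t. t \<in> S \<Longrightarrow> \<exists>n. \<forall>m. m \<noteq> n \<longrightarrow> R m t \<in> {0, 1}"
  shows "continuous_on S (glue x (\<lambda>n t. \<alpha> n (R n t)))"
proof (rule continuous_on_glue)
  show "continuous_on S (\<lambda>t. \<alpha> n (R n t))" for n
    by (rule continuous_on_compose2[OF based_loopD(1)[OF null_sequenceD(1)[OF \<alpha>]] R])
  show "\<exists>n. \<forall>m. m \<noteq> n \<longrightarrow> \<alpha> m (R m t) = x" if "t \<in> S" for t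
    using sep[OF that] based_loop_01[OF null_sequenceD(1)[OF \<alpha>]] by meson
  show "\<forall>\<^sub>F n in sequentially. (\<lambda>t. \<alpha> n (R n t)) ` S \<subseteq> U" if "open U" "x \<in> U" for U
    using null_sequenceD(2)[OF \<alpha> that] by eventually_elim (use R(2) in blast)
qed

lemma loop_product_end:
  assumes "collapse_family r" "\<And>n. based_loop x (\<alpha> n)"
  shows "loop_product x r \<alpha> 0 = x" "loop_product x r \<alpha> 1 = x"
  unfolding loop_product_def glue_def
  using collapse_familyD(3,4)[OF assms(1)] based_loopD(2,3)[OF assms(2)] by auto

lemma based_loop_loop_product:
  assumes "null_sequence x \<alpha>" "collapse_family r"
  shows "based_loop x (loop_product x r \<alpha>)"
proof -
  have "continuous_on {0..1} (loop_product x r \<alpha>)"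
    unfolding loop_product_def
    by (rule continuous_on_glue_null_sequence[OF assms(1)])
      (use collapse_familyD[OF assms(2)] in auto)
  then show ?thesis
    using loop_product_end[OF assms(2) null_sequenceD(1)[OF assms(1)]]
    by (auto simp: based_loop_def path_def pathstart_def pathfinish_def)
qed

text \<open>All \<open>r n\<close> are moved to \<open>q n\<close> along straight lines at once.
  Where \<open>r m t\<close> and \<open>q m t\<close> agree in 0 or 1 the interpolation stays put,
  so at each point of the square at most one factor is active.\<close>

lemma homotopic_loop_product:
  assumes \<alpha>: "null_sequence x \<alpha>" and r: "collapse_family r" and q: "collapse_family q"
    and sep: "\<And>t. t \<in> {0..1} \<Longrightarrow> \<exists>n. \<forall>m. m \<noteq> n \<longrightarrow> r m t \<in> {0, 1} \<and> q m t = r m t"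
  shows "homotopic_paths UNIV (loop_product x r \<alpha>) (loop_product x q \<alpha>)"
proof -
  define R where "R n z = (1 - fst z) * r n (snd z) + fst z * q n (snd z)" for n and z :: "real \<times> real"
  define h where "h = glue x (\<lambda>n z. \<alpha> n (R n z))"
  let ?Q = "{0..1} \<times> {0..1::real}"
  have "continuous_on ?Q h"
    unfolding h_def
  proof (rule continuous_on_glue_null_sequence[OF \<alpha>])
    show "continuous_on ?Q (R n)" for n
      unfolding R_def
      by (intro continuous_intros continuous_on_compose2[OF collapse_familyD(1)[OF r]]
          continuous_on_compose2[OF collapse_familyD(1)[OF q]]) auto
    show "R n ` ?Q \<subseteq> {0..1}" for n
    proof
      fix y assume "y \<in> R n ` ?Q"
      then obtain s t where st: "s \<in> {0..1}" "t \<in> {0..1}" "y = (1 - s) * r n t + s * q n t"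
        unfolding R_def by auto
      then show "y \<in> {0..1}"
        using collapse_familyD(2)[OF r, of t n] collapse_familyD(2)[OF q, of t n]
        by (auto intro!: convex_bound_le)
    qed
    show "\<exists>n. \<forall>m. m \<noteq> n \<longrightarrow> R m z \<in> {0, 1}" if z: "z \<in> ?Q" for z
    proof -
      obtain n where n: "\<And>m. m \<noteq> n \<Longrightarrow> r m (snd z) \<in> {0, 1} \<and> q m (snd z) = r m (snd z)"
        using sep[of "snd z"] z by (metis mem_Times_iff)
      have "R m z = r m (snd z)" if "m \<noteq> n" for m
        using n[OF that] by (simp add: R_def algebra_simps)
      then show ?thesis using n by metis
    qed
  qed
  moreover have "h (0, t) = loop_product x r \<alpha> t" "h (1, t) = loop_product x q \<alpha> t" for t
    unfolding h_def loop_product_def glue_def R_def by simp_all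
  moreover have "h (s, 0) = x" "h (s, 1) = x" for s
    unfolding h_def glue_def R_def
    using collapse_familyD(3,4)[OF r] collapse_familyD(3,4)[OF q]
      based_loopD(2,3)[OF null_sequenceD(1)[OF \<alpha>]] by auto
  ultimately show ?thesis
    unfolding homotopic_paths
    using loop_product_end[OF r null_sequenceD(1)[OF \<alpha>]]
    by (intro exI[of _ h]) (auto simp: pathstart_def pathfinish_def)
qed

section \<open>Products of order type \<omega>\<close>

text \<open>Collapses the complement of the interval from \<open>1 - 1 / 2 ^ n\<close> to \<open>1 - 1 / 2 ^ (n + 1)\<close>.\<close>
definition dyadic_collapse :: "nat \<Rightarrow> real \<Rightarrow> real" where
  "dyadic_collapse n t = max 0 (min 1 (2 ^ (n + 1) * (t - 1) + 2))"

text \<open>The pattern is self-similar: the right half of the unit interval repeats it one index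
  later.\<close>

lemma dyadic_collapse_Suc: "dyadic_collapse (Suc n) t = dyadic_collapse n (2 * t - 1)"
  by (simp add: dyadic_collapse_def algebra_simps)

lemma collapse_family_dyadic: "collapse_family dyadic_collapse"
proof -
  have "\<exists>n. \<forall>m. m \<noteq> n \<longrightarrow> dyadic_collapse m t \<in> {0, 1}" if t: "t \<in> {0..1}" for t
  \<comment> \<open>The inequality says \<open>t < 1 - 1 / 2 ^ (n + 1)\<close>, so the least such
    \<open>n\<close> numbers the interval containing \<open>t\<close>; there is none only at
    \<open>t = 1\<close>.\<close>
  proof (cases "\<exists>n. 2 ^ (n + 1) * (1 - t) > 1")
    case False
    then have "dyadic_collapse m t = 1" for m
      using not_less[of 1 "2 ^ (m + 1) * (1 - t)"] unfolding dyadic_collapse_def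
      by (auto simp: algebra_simps)
    then show ?thesis by auto
  next
    case True
    define n where "n = (LEAST n. 2 ^ (n + 1) * (1 - t) > 1)"
    have n: "2 ^ (n + 1) * (1 - t) > 1" unfolding n_def using True by (rule LeastI_ex)
    have "dyadic_collapse m t \<in> {0, 1}" if "m \<noteq> n" for m
    proof (cases "m < n")
      case True
      then have "\<not> 2 ^ (m + 1) * (1 - t) > 1" unfolding n_def by (rule not_less_Least)
      then have "dyadic_collapse m t = 1" unfolding dyadic_collapse_def by (auto simp: algebra_simps)
      then show ?thesis by simp
    next
      case False
      then have "n + 1 \<le> m" using that by simp
      then have "(2::real) ^ (n + 1) \<le> 2 ^ m" by (rule power_increasing) simp
      then have "2 ^ (n + 1) * (1 - t) \<le> 2 ^ m * (1 - t)" using t by (intro mult_right_mono) auto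
      then have "2 ^ m * (1 - t) \<ge> 1" using n by linarith
      then have "dyadic_collapse m t = 0" unfolding dyadic_collapse_def by (auto simp: algebra_simps)
      then show ?thesis by simp
    qed
    then show ?thesis by blast
  qed
  moreover have "dyadic_collapse n 0 = 0" for n
  proof -
    have "(2::real) ^ n \<ge> 1" by simp
    then have "2 ^ (n + 1) * (0 - 1) + 2 \<le> (0::real)" by (simp del: one_le_power)
    then show ?thesis unfolding dyadic_collapse_def by linarith
  qed
  moreover have "continuous_on {0..1} (dyadic_collapse n)" for n
    unfolding dyadic_collapse_def by (intro continuous_intros)
  moreover have "dyadic_collapse n 1 = 1" "dyadic_collapse n t \<in> {0..1}" for n t
    unfolding dyadic_collapse_def by auto
  ultimately show ?thesis unfolding collapse_family_def by blast
qed

text \<open>Interval 0 is the left half and carries \<open>\<beta> 0\<close>; by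
  \<open>dyadic_collapse_Suc\<close> the right half carries the product of the shifted
  sequence.\<close>

lemma loop_product_dyadic_Suc:
  assumes "\<And>n. based_loop x (\<beta> n)" "t \<in> {0..1}"
  shows "loop_product x dyadic_collapse \<beta> t =
    (\<beta> 0 +++ loop_product x dyadic_collapse (\<lambda>n. \<beta> (Suc n))) t"
proof (cases "t \<le> 1/2")
  case True
  have "dyadic_collapse m t = 0" if "m \<noteq> 0" for m
  proof -
    have "(2::real) ^ 1 \<le> 2 ^ m" using that by (intro power_increasing) auto
    then have "2 * (1 - t) \<le> 2 ^ m * (1 - t)" using True by (intro mult_right_mono) auto
    then show ?thesis using True unfolding dyadic_collapse_def by (simp add: algebra_simps)
  qed
  then have "loop_product x dyadic_collapse \<beta> t = \<beta> 0 (dyadic_collapse 0 t)"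
    unfolding loop_product_def using based_loopD(2)[OF assms(1)] by (intro glue_eq) auto
  also have "dyadic_collapse 0 t = 2 * t"
    using True assms(2) by (auto simp: dyadic_collapse_def)
  finally show ?thesis using True by (simp add: joinpaths_def)
next
  case False
  define s where "s = 2 * t - 1"
  have s: "s \<in> {0..1}" using False assms(2) by (auto simp: s_def)
  obtain n where n: "\<And>m. m \<noteq> n \<Longrightarrow> dyadic_collapse m s \<in> {0, 1}"
    using collapse_familyD(5)[OF collapse_family_dyadic s] by blast
  have "dyadic_collapse 0 t = 1" using False by (auto simp: dyadic_collapse_def)
  then have "dyadic_collapse m t \<in> {0, 1}" if "m \<noteq> Suc n" for m
    using that n by (cases m) (auto simp: dyadic_collapse_Suc s_def)
  then have "loop_product x dyadic_collapse \<beta> t = \<beta> (Suc n) (dyadic_collapse (Suc n) t)"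
    unfolding loop_product_def using based_loopD(2,3)[OF assms(1)] by (intro glue_eq) fastforce
  moreover have "loop_product x dyadic_collapse (\<lambda>n. \<beta> (Suc n)) s = \<beta> (Suc n) (dyadic_collapse n s)"
    unfolding loop_product_def using n based_loopD(2,3)[OF assms(1)]
    by (intro glue_eq[of n "\<lambda>n t. \<beta> (Suc n) (dyadic_collapse n t)"]) fastforce
  ultimately show ?thesis using False by (simp add: joinpaths_def dyadic_collapse_Suc s_def)
qed

section \<open>Continuity of products of maps on convex sets\<close>

text \<open>Excursions from \<open>a\<close> to \<open>u n\<close> and back along segments form a
  null-sequence of loops, and their product of order type \<omega> passes through every
  \<open>u n\<close>. Convexity keeps the segments in \<open>S\<close>.\<close>

lemma path_through_sequence:
  fixes S :: "'b::real_normed_vector set"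
  assumes S: "convex S" "\<And>n. u n \<in> S" "a \<in> S" and lim: "u \<longlonglongrightarrow> a"
  obtains \<gamma> where "path \<gamma>" "path_image \<gamma> \<subseteq> S" "\<gamma> 1 = a" "\<And>n. \<gamma> (1 - 3 / 4 / 2 ^ n) = u n"
proof -
  \<comment> \<open>The factor \<open>1 - \<bar>2 * t - 1\<bar>\<close> is a tent, 0 at both ends
    and 1 in the middle.\<close>
  define \<beta> where "\<beta> n t = (1 - (1 - \<bar>2 * t - 1\<bar>)) *\<^sub>R a + (1 - \<bar>2 * t - 1\<bar>) *\<^sub>R u n" for n and t :: real
  have conv: "\<beta> n t \<in> V" if "convex V" "a \<in> V" "u n \<in> V" "t \<in> {0..1}" for n t V
    unfolding \<beta>_def using that by (intro convexD_alt) auto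
  have null: "null_sequence a \<beta>"
    unfolding null_sequence_def
  proof (intro conjI allI impI)
    show "based_loop a (\<beta> n)" for n
      unfolding based_loop_def path_def pathstart_def pathfinish_def \<beta>_def
      by (auto intro!: continuous_intros)
    fix U :: "'b set" assume U: "open U" "a \<in> U"
    then obtain \<epsilon> where \<epsilon>: "\<epsilon> > 0" "ball a \<epsilon> \<subseteq> U" using open_contains_ball by blast
    have "\<forall>\<^sub>F n in sequentially. u n \<in> ball a \<epsilon>"
      using \<epsilon>(1) by (intro topological_tendstoD[OF lim]) auto
    then show "\<forall>\<^sub>F n in sequentially. path_image (\<beta> n) \<subseteq> U"
    proof eventually_elim
      case (elim n)
      then show ?case
        using conv[of "ball a \<epsilon>" n] \<epsilon> unfolding path_image_def by auto
    qed
  qed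
  define \<gamma> where "\<gamma> = loop_product a dyadic_collapse \<beta>"
  have loop: "based_loop a \<gamma>"
    unfolding \<gamma>_def by (rule based_loop_loop_product[OF null collapse_family_dyadic])
  have "\<gamma> (1 - 3 / 4 / 2 ^ n) = u n" for n
  proof -
    \<comment> \<open>This is the midpoint of the \<open>n\<close>-th dyadic interval, where the
      tent peaks.\<close>
    define t :: real where "t = 1 - 3 / 4 / 2 ^ n"
    have "3 / 4 / (2::real) ^ n \<le> 1" using one_le_power[of "2::real" n]
      by (simp add: divide_simps del: one_le_power)
    then have t: "t \<in> {0..1}" unfolding t_def by auto
    have half: "dyadic_collapse n t = 1 / 2" unfolding dyadic_collapse_def t_def by simp
    obtain k where k: "\<And>m. m \<noteq> k \<Longrightarrow> dyadic_collapse m t \<in> {0, 1}"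
      using collapse_familyD(5)[OF collapse_family_dyadic t] by blast
    have "k = n" using k[of n] half by auto
    then have "\<gamma> t = \<beta> n (dyadic_collapse n t)"
      unfolding \<gamma>_def loop_product_def
      using k based_loopD(2,3)[OF null_sequenceD(1)[OF null]] by (intro glue_eq) fastforce
    also have "\<dots> = u n" unfolding half by (simp add: \<beta>_def)
    finally show ?thesis unfolding t_def .
  qed
  moreover have "path_image \<gamma> \<subseteq> S"
    unfolding path_image_def \<gamma>_def loop_product_def
    using conv[OF S(1,3,2)] collapse_familyD(2)[OF collapse_family_dyadic] S(3)
    by (auto intro!: glue_in)
  ultimately show ?thesis
    using that loop unfolding based_loop_def pathfinish_def by blast
qed

lemma pre_delta_monoidD:
  assumes "pre_delta_monoid mul e"
  shows "mul e x = x" "mul x e = x" "mul (mul x y) z = mul x (mul y z)"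
    "path \<alpha> \<Longrightarrow> path \<beta> \<Longrightarrow> path (\<lambda>t. mul (\<alpha> t) (\<beta> t))"
  using assms unfolding pre_delta_monoid_def by blast+

text \<open>Continuity on \<open>S\<close> can be tested on convergent sequences, and each of them
  lies on a path in \<open>S\<close>, along which the hypothesis on products of paths applies. With
  the unit square as \<open>S\<close> this produces homotopies.\<close>

lemma pre_delta_monoid_continuous_on:
  fixes S :: "'b::real_normed_vector set"
  assumes M: "pre_delta_monoid mul e" and S: "convex S"
    and f: "continuous_on S f" and g: "continuous_on S g"
  shows "continuous_on S (\<lambda>z. mul (f z) (g z))"
proof (rule continuous_on_sequentiallyI)
  fix u a assume u: "\<forall>n. u n \<in> S" "a \<in> S" "u \<longlonglongrightarrow> a"
  then obtain \<gamma> where \<gamma>: "path \<gamma>" "path_image \<gamma> \<subseteq> S" "\<gamma> 1 = a" "\<And>n. \<gamma> (1 - 3 / 4 / 2 ^ n) = u n"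
    using path_through_sequence[OF S] by metis
  define s :: "nat \<Rightarrow> real" where "s n = 1 - 3 / 4 / 2 ^ n" for n
  have "path (f \<circ> \<gamma>)" "path (g \<circ> \<gamma>)"
    using \<gamma> f g by (auto intro!: path_continuous_image intro: continuous_on_subset)
  from pre_delta_monoidD(4)[OF M this]
  have cont: "continuous_on {0..1} (\<lambda>t. mul (f (\<gamma> t)) (g (\<gamma> t)))" by (simp add: path_def)
  have "(\<lambda>n. 1 - 3 / 4 * (1 / 2) ^ n :: real) \<longlonglongrightarrow> 1 - 3 / 4 * 0"
    by (intro tendsto_intros LIMSEQ_power_zero) auto
  then have lim: "s \<longlonglongrightarrow> 1" by (simp add: s_def[abs_def] power_one_over field_simps)
  have s01: "s n \<in> {0..1}" for n
    unfolding s_def using one_le_power[of "2::real" n] by (simp add: divide_simps del: one_le_power)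
  have "(\<lambda>n. mul (f (\<gamma> (s n))) (g (\<gamma> (s n)))) \<longlonglongrightarrow> mul (f (\<gamma> 1)) (g (\<gamma> 1))"
    by (rule continuous_on_tendsto_compose[OF cont lim]) (use s01 in auto)
  then show "(\<lambda>n. mul (f (u n)) (g (u n))) \<longlonglongrightarrow> mul (f a) (g a)"
    using \<gamma>(3,4) by (simp add: s_def)
qed

section \<open>Pointwise product, concatenation and cancellation\<close>

text \<open>An Eckmann-Hilton deformation: \<open>f\<close> is squeezed into the first half and
  \<open>g\<close> into the second, each being \<open>e\<close> on the other half.\<close>

lemma homotopic_paths_mul_join:
  assumes M: "pre_delta_monoid mul e" and f: "based_loop e f" and g: "based_loop e g"
  shows "homotopic_paths UNIV (\<lambda>t. mul (f t) (g t)) (f +++ g)"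
proof -
  let ?Q = "{0..1} \<times> {0..1::real}"
  define F where "F z = f ((1 - fst z) * snd z + fst z * min 1 (2 * snd z))" for z :: "real \<times> real"
  define G where "G z = g ((1 - fst z) * snd z + fst z * max 0 (2 * snd z - 1))" for z :: "real \<times> real"
  have "continuous_on ?Q F"
    unfolding F_def
    by (rule continuous_on_compose2[OF based_loopD(1)[OF f]])
      (auto intro!: continuous_intros convex_bound_le)
  moreover have "continuous_on ?Q G"
    unfolding G_def
    by (rule continuous_on_compose2[OF based_loopD(1)[OF g]])
      (auto intro!: continuous_intros convex_bound_le)
  ultimately have "continuous_on ?Q (\<lambda>z. mul (F z) (G z))"
    by (intro pre_delta_monoid_continuous_on[OF M] convex_Times) auto
  moreover have "mul (F (1, t)) (G (1, t)) = (f +++ g) t" if "t \<in> {0..1}" for t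
  proof (cases "t \<le> 1 / 2")
    case True
    then have "min 1 (2 * t) = 2 * t" "max 0 (2 * t - 1) = 0" by auto
    with True show ?thesis
      using based_loopD(2)[OF g] by (simp add: F_def G_def joinpaths_def pre_delta_monoidD(2)[OF M])
  next
    case False
    then have "min 1 (2 * t) = 1" "max 0 (2 * t - 1) = 2 * t - 1" by auto
    with False show ?thesis
      using based_loopD(3)[OF f] by (simp add: F_def G_def joinpaths_def pre_delta_monoidD(1)[OF M])
  qed
  ultimately show ?thesis
    unfolding homotopic_paths
    using based_loopD(2,3)[OF f] based_loopD(2,3)[OF g]
    by (intro exI[of _ "\<lambda>z. mul (F z) (G z)"]) (auto simp: F_def G_def pathstart_def pathfinish_def)
qed

text \<open>Appending \<open>reversepath v\<close> undoes \<open>v\<close>, as in the fundamental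
  groupoid.\<close>

lemma homotopic_paths_rcancel:
  fixes a b v :: "real \<Rightarrow> 'a::topological_space"
  assumes v: "path v" and a: "path a" "pathfinish a = pathstart v"
    and b: "path b" "pathfinish b = pathstart v"
    and hom: "homotopic_paths UNIV (a +++ v) (b +++ v)"
  shows "homotopic_paths UNIV a b"
proof -
  have id: "p \<circ> linepath 0 (1::real) = p" for p :: "real \<Rightarrow> 'a"
    by (auto simp: linepath_def)
  let ?c = "\<lambda>t::real. pathstart v"
  \<comment> \<open>The library proves the unit and inverse laws of path composition in normed spaces only;
    here they are transported from the unit interval.\<close>
  have "homotopic_paths UNIV (v \<circ> (linepath 0 1 +++ reversepath (linepath 0 1))) (v \<circ> linepath 0 0)"
    using homotopic_paths_rinv[of "linepath 0 (1::real)" "{0..1}"] v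
    by (intro homotopic_paths_continuous_image[where S = "{0..1}"])
      (auto simp: path_def closed_segment_eq_real_ivl)
  moreover have "v \<circ> (linepath 0 1 +++ reversepath (linepath 0 1)) = v +++ reversepath v"
    by (auto simp: fun_eq_iff joinpaths_def reversepath_def linepath_def)
  moreover have "v \<circ> linepath 0 0 = ?c" by (auto simp: linepath_def pathstart_def)
  ultimately have rinv: "homotopic_paths UNIV (v +++ reversepath v) ?c" by simp
  have main: "homotopic_paths UNIV p ((p +++ v) +++ reversepath v)"
    if p: "path p" "pathfinish p = pathstart v" for p
  proof -
    have "homotopic_paths UNIV (p \<circ> (linepath 0 1 +++ linepath 1 1)) (p \<circ> linepath 0 1)"
      using homotopic_paths_rid[of "linepath 0 (1::real)" "{0..1}"] p
      by (intro homotopic_paths_continuous_image[where S = "{0..1}"])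
        (auto simp: path_def closed_segment_eq_real_ivl)
    moreover have "p \<circ> (linepath 0 1 +++ linepath 1 1) = p +++ ?c"
      using p(2) by (auto simp: fun_eq_iff joinpaths_def linepath_def pathfinish_def)
    ultimately have "homotopic_paths UNIV p (p +++ ?c)"
      by (simp add: id homotopic_paths_sym)
    also have "homotopic_paths UNIV (p +++ ?c) (p +++ (v +++ reversepath v))"
      using p rinv by (intro homotopic_paths_join) (auto simp: homotopic_paths_sym pathstart_def)
    also have "homotopic_paths UNIV (p +++ (v +++ reversepath v)) ((p +++ v) +++ reversepath v)"
      using p v by (intro homotopic_paths_assoc) auto
    finally show ?thesis .
  qed
  have "homotopic_paths UNIV a ((a +++ v) +++ reversepath v)" by (rule main[OF a])
  also have "homotopic_paths UNIV \<dots> ((b +++ v) +++ reversepath v)"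
    using v by (intro homotopic_paths_join[OF hom]) auto
  also have "homotopic_paths UNIV \<dots> b"
    using main[OF b] by (rule homotopic_paths_sym)
  finally show ?thesis .
qed

section \<open>Reduction of arbitrary products to order type \<omega>\<close>

lemma null_sequence_Suc: "null_sequence x \<beta> \<Longrightarrow> null_sequence x (\<lambda>n. \<beta> (Suc n))"
  unfolding null_sequence_def
  using eventually_sequentially_Suc[of "\<lambda>n. path_image (\<beta> n) \<subseteq> U" for U] by blast

lemma null_sequence_reparametrize:
  assumes "null_sequence x \<alpha>" "collapse_family r"
  shows "null_sequence x (\<lambda>n t. \<alpha> n (r n t))"
  unfolding null_sequence_def
proof (intro conjI allI impI)
  show "based_loop x (\<lambda>t. \<alpha> n (r n t))" for n
  proof -
    have "continuous_on {0..1} (\<lambda>t. \<alpha> n (r n t))"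
      by (rule continuous_on_compose2[OF based_loopD(1)[OF null_sequenceD(1)[OF assms(1)]]
            collapse_familyD(1)[OF assms(2)]]) (use collapse_familyD(2)[OF assms(2)] in blast)
    then show ?thesis
      using collapse_familyD(3,4)[OF assms(2)] based_loopD(2,3)[OF null_sequenceD(1)[OF assms(1)]]
      by (simp add: based_loop_def path_def pathstart_def pathfinish_def)
  qed
  show "\<forall>\<^sub>F n in sequentially. path_image (\<lambda>t. \<alpha> n (r n t)) \<subseteq> U" if "open U" "x \<in> U" for U
    using null_sequenceD(2)[OF assms(1) that]
    by eventually_elim (use collapse_familyD(2)[OF assms(2)] in \<open>auto simp: path_image_def\<close>)
qed

text \<open>The product from index \<open>n\<close> on takes only the value \<open>x\<close> and
  values of the \<open>\<alpha> k\<close> with \<open>k \<ge> n\<close>, so it lies in a given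
  neighbourhood of \<open>x\<close> for large \<open>n\<close>. Hence the tails can themselves be
  multiplied.\<close>

lemma null_sequence_tail_products:
  assumes \<alpha>: "null_sequence x \<alpha>" and r: "collapse_family r"
  shows "null_sequence x (\<lambda>n. loop_product x r (\<lambda>k. if k < n then (\<lambda>_. x) else \<alpha> k))"
  unfolding null_sequence_def
proof (intro conjI allI impI)
  fix n
  have "null_sequence x (\<lambda>k. if k < n then (\<lambda>_. x) else \<alpha> k)"
    using \<alpha> unfolding null_sequence_def
    by (auto simp: based_loop_def pathstart_def pathfinish_def path_def path_image_def
        elim!: eventually_mono)
  then show "based_loop x (loop_product x r (\<lambda>k. if k < n then (\<lambda>_. x) else \<alpha> k))"
    using r by (rule based_loop_loop_product)
next
  fix U :: "'a set" assume U: "open U" "x \<in> U"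
  obtain N where N: "\<And>k. k \<ge> N \<Longrightarrow> \<alpha> k ` {0..1} \<subseteq> U"
    using null_sequenceD(2)[OF \<alpha> U] unfolding eventually_sequentially by blast
  show "\<forall>\<^sub>F n in sequentially. path_image (loop_product x r (\<lambda>k. if k < n then (\<lambda>_. x) else \<alpha> k)) \<subseteq> U"
    unfolding eventually_sequentially path_image_def loop_product_def
  proof (intro exI allI impI image_subsetI glue_in)
    fix n t k assume "N \<le> n" "t \<in> {0..1::real}"
    then show "(if k < n then (\<lambda>_. x) else \<alpha> k) (r k t) \<in> U"
      using N[of k] collapse_familyD(2)[OF r, of t k] U by (simp add: image_subset_iff)
  qed (rule U)
qed

text \<open>Both products use the same \<open>r\<close>, so at time \<open>t\<close> the same single
  index is active in both, and all other factors are \<open>e\<close>.\<close>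

lemma loop_product_mul:
  assumes M: "pre_delta_monoid mul e" and r: "collapse_family r"
    and \<alpha>: "\<And>n. based_loop e (\<alpha> n)" and \<beta>: "\<And>n. based_loop e (\<beta> n)" and t: "t \<in> {0..1}"
  shows "mul (loop_product e r \<alpha> t) (loop_product e r \<beta> t) =
    loop_product e r (\<lambda>n s. mul (\<alpha> n s) (\<beta> n s)) t"
proof -
  obtain n where n: "\<And>m. m \<noteq> n \<Longrightarrow> r m t \<in> {0, 1}"
    using collapse_familyD(5)[OF r t] by blast
  have "loop_product e r \<alpha> t = \<alpha> n (r n t)" "loop_product e r \<beta> t = \<beta> n (r n t)"
    unfolding loop_product_def
    by (rule glue_eq, rule based_loop_01[OF \<alpha> n], assumption)
      (rule glue_eq, rule based_loop_01[OF \<beta> n], assumption)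
  moreover have "loop_product e r (\<lambda>n s. mul (\<alpha> n s) (\<beta> n s)) t = mul (\<alpha> n (r n t)) (\<beta> n (r n t))"
    unfolding loop_product_def
    by (rule glue_eq) (use based_loop_01[OF \<alpha> n] based_loop_01[OF \<beta> n] pre_delta_monoidD(1)[OF M] in auto)
  ultimately show ?thesis by simp
qed

lemma loop_product_cong:
  assumes "collapse_family r" "t \<in> {0..1}" "\<And>n s. s \<in> {0..1} \<Longrightarrow> \<alpha> n s = \<beta> n s"
  shows "loop_product x r \<alpha> t = loop_product x r \<beta> t"
  unfolding loop_product_def glue_def
  using assms(3)[OF collapse_familyD(2)[OF assms(1,2)]] by simp

text \<open>Separation is inherited from \<open>q\<close>, because each \<open>r n\<close> fixes 0
  and 1.\<close>

lemma collapse_family_compose: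
  assumes r: "collapse_family r" and q: "collapse_family q"
  shows "collapse_family (\<lambda>n t. r n (q n t))"
proof -
  have "continuous_on {0..1} (\<lambda>t. r n (q n t))" for n
    using continuous_on_compose2[OF collapse_familyD(1)[OF r] collapse_familyD(1)[OF q]]
      collapse_familyD(2)[OF q] by blast
  moreover have "\<exists>n. \<forall>m. m \<noteq> n \<longrightarrow> r m (q m t) \<in> {0, 1}" if "t \<in> {0..1}" for t
    using collapse_familyD(5)[OF q that] collapse_familyD(3,4)[OF r] by (metis insert_iff singletonD)
  ultimately show ?thesis
    using collapse_familyD(2-4)[OF r] collapse_familyD(2-4)[OF q]
    unfolding collapse_family_def by (simp add: image_subset_iff)
qed

text \<open>The second product does not mention \<open>r\<close>, so the homotopy class depends on
  the sequence alone.\<close>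

proposition homotopic_loop_product_dyadic:
  assumes M: "pre_delta_monoid mul e" and \<alpha>: "null_sequence e \<alpha>" and r: "collapse_family r"
  shows "homotopic_paths UNIV (loop_product e r \<alpha>) (loop_product e dyadic_collapse \<alpha>)"
proof -
  let ?W = "loop_product e dyadic_collapse"
  define p where "p n = loop_product e r (\<lambda>k. if k < n then (\<lambda>_. e) else \<alpha> k)" for n
  define a where "a n t = \<alpha> n (r n t)" for n t
  define V where "V = ?W (\<lambda>n. p (Suc n))"
  have p: "null_sequence e p"
    using null_sequence_tail_products[OF \<alpha> r] by (simp add: p_def[abs_def])
  have a: "null_sequence e a"
    using null_sequence_reparametrize[OF \<alpha> r] by (simp add: a_def[abs_def])
  have V: "based_loop e V"
    unfolding V_def by (rule based_loop_loop_product[OF null_sequence_Suc[OF p] collapse_family_dyadic])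
  have Wa: "based_loop e (?W a)"
    by (rule based_loop_loop_product[OF a collapse_family_dyadic])
  have Wp: "based_loop e (?W p)"
    by (rule based_loop_loop_product[OF p collapse_family_dyadic])
  \<comment> \<open>At time \<open>t\<close> only one index \<open>j\<close> is active. If
    \<open>n = j\<close>, then \<open>p (Suc n) t = e\<close>; otherwise \<open>a n t = e\<close>
    and the two tails agree at \<open>t\<close>.\<close>
  have p_Suc: "p n t = mul (a n t) (p (Suc n) t)" if t: "t \<in> {0..1}" for n t
  proof -
    obtain j where j: "\<And>m. m \<noteq> j \<Longrightarrow> r m t \<in> {0, 1}"
      using collapse_familyD(5)[OF r t] by blast
    have x: "\<alpha> m (r m t) = e" if "m \<noteq> j" for m
      by (rule based_loop_01[OF null_sequenceD(1)[OF \<alpha>] j[OF that]])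
    have pk: "p k t = (if j < k then e else \<alpha> j (r j t))" for k
      unfolding p_def loop_product_def
      using glue_eq[of j "\<lambda>m t. (if m < k then (\<lambda>_. e) else \<alpha> m) (r m t)" t e] x by auto
    show ?thesis
      unfolding pk a_def using x[of n] by (cases "n = j") (auto simp: pre_delta_monoidD(1,2)[OF M])
  qed
  \<comment> \<open>Here the first factor of \<open>?W p\<close> is split off; the next step instead
    factors every \<open>p n\<close> pointwise. Both leave the same \<open>V\<close> on the right,
    which is then cancelled.\<close>
  have "homotopic_paths UNIV (p 0 +++ V) (?W p)"
  proof (rule homotopic_paths_sym, rule homotopic_paths_eq)
    show "?W p t = (p 0 +++ V) t" if "t \<in> {0..1}" for t
      unfolding V_def by (rule loop_product_dyadic_Suc[OF null_sequenceD(1)[OF p] that])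
  qed (use Wp in \<open>auto simp: based_loop_def\<close>)
  also have "homotopic_paths UNIV (?W p) (\<lambda>t. mul (?W a t) (V t))"
  proof (rule homotopic_paths_eq)
    show "?W p t = mul (?W a t) (V t)" if t: "t \<in> {0..1}" for t
      unfolding V_def
        loop_product_mul[OF M collapse_family_dyadic null_sequenceD(1)[OF a]
          null_sequenceD(1)[OF null_sequence_Suc[OF p]] t]
      using p_Suc by (intro loop_product_cong[OF collapse_family_dyadic t])
  qed (use Wp in \<open>auto simp: based_loop_def\<close>)
  also have "homotopic_paths UNIV \<dots> (?W a +++ V)"
    by (rule homotopic_paths_mul_join[OF M Wa V])
  finally have "homotopic_paths UNIV (p 0) (?W a)"
    using V Wa null_sequenceD(1)[OF p, of 0] homotopic_paths_rcancel[of V "p 0" "?W a"]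
    by (auto simp: based_loop_def)
  moreover have "p 0 = loop_product e r \<alpha>" by (simp add: p_def)
  moreover have "?W a = loop_product e (\<lambda>n t. r n (dyadic_collapse n t)) \<alpha>"
    by (simp add: loop_product_def a_def)
  \<comment> \<open>Each \<open>r n\<close> fixes 0 and 1, so it can be straightened to the identity
    within all dyadic intervals at once.\<close>
  moreover have "homotopic_paths UNIV (loop_product e (\<lambda>n t. r n (dyadic_collapse n t)) \<alpha>) (?W \<alpha>)"
  proof (rule homotopic_loop_product[OF \<alpha> collapse_family_compose[OF r collapse_family_dyadic]
        collapse_family_dyadic])
    fix t :: real assume "t \<in> {0..1}"
    then obtain n where n: "\<And>m. m \<noteq> n \<Longrightarrow> dyadic_collapse m t \<in> {0, 1}"
      using collapse_familyD(5)[OF collapse_family_dyadic] by blast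
    have "r m (dyadic_collapse m t) = dyadic_collapse m t" if "m \<noteq> n" for m
      using n[OF that] collapse_familyD(3,4)[OF r] by auto
    then show "\<exists>n. \<forall>m. m \<noteq> n \<longrightarrow> r m (dyadic_collapse m t) \<in> {0, 1} \<and>
        dyadic_collapse m t = r m (dyadic_collapse m t)"
      using n by metis
  qed
  ultimately show ?thesis by (metis homotopic_paths_trans)
qed

section \<open>Permutation of the factors\<close>

text \<open>Moves the permutation from the loops to the intervals: the loop
  \<open>\<alpha> k\<close> sits where \<open>r (inv \<phi> k)\<close> is active. Both products to
  be compared then belong to the same sequence.\<close>

lemma loop_product_permute:
  assumes "bij \<phi>" and r: "collapse_family r" and \<alpha>: "\<And>n. based_loop x (\<alpha> n)" and t: "t \<in> {0..1}"
  shows "loop_product x r (\<lambda>n. \<alpha> (\<phi> n)) t = loop_product x (\<lambda>n. r (inv \<phi> n)) \<alpha> t"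
proof -
  obtain n where n: "\<And>m. m \<noteq> n \<Longrightarrow> r m t \<in> {0, 1}"
    using collapse_familyD(5)[OF r t] by blast
  have inv: "inv \<phi> (\<phi> k) = k" "\<phi> (inv \<phi> k) = k" for k
    using assms(1) by (auto simp: bij_is_inj bij_is_surj surj_f_inv_f)
  have "loop_product x r (\<lambda>n. \<alpha> (\<phi> n)) t = \<alpha> (\<phi> n) (r n t)"
    unfolding loop_product_def by (rule glue_eq) (rule based_loop_01[OF \<alpha> n])
  moreover have "loop_product x (\<lambda>n. r (inv \<phi> n)) \<alpha> t = \<alpha> (\<phi> n) (r (inv \<phi> (\<phi> n)) t)"
    unfolding loop_product_def
  proof (rule glue_eq)
    fix m assume "m \<noteq> \<phi> n"
    then have "inv \<phi> m \<noteq> n" using inv by metis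
    then show "\<alpha> m (r (inv \<phi> m) t) = x" by (rule based_loop_01[OF \<alpha> n])
  qed
  ultimately show ?thesis by (simp add: inv)
qed

lemma collapse_family_permute:
  assumes "bij \<phi>" "collapse_family r"
  shows "collapse_family (\<lambda>n. r (inv \<phi> n))"
proof -
  have "\<exists>n. \<forall>m. m \<noteq> n \<longrightarrow> r (inv \<phi> m) t \<in> {0, 1}" if t: "t \<in> {0..1}" for t
  proof -
    obtain n where n: "\<And>m. m \<noteq> n \<Longrightarrow> r m t \<in> {0, 1}"
      using collapse_familyD(5)[OF assms(2) t] by blast
    have "inv \<phi> m \<noteq> n" if "m \<noteq> \<phi> n" for m
      using that assms(1) by (metis bij_inv_eq_iff)
    then show ?thesis using n by blast
  qed
  then show ?thesis using assms(2) unfolding collapse_family_def by blast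
qed

section \<open>Self-similarity and disjointness of the Cantor gaps\<close>

text \<open>The leading binary digit of \<open>i\<close> selects the left or right third; the
  remaining digits locate the gap in a copy scaled by 1/3.\<close>

lemma cantor_left_Suc:
  "cantor_left (Suc (Suc m)) (Suc i) =
    2 / 3 * real (i div 2 ^ m mod 2) + cantor_left (Suc m) (Suc (i mod 2 ^ m)) / 3"
proof -
  \<comment> \<open>As \<open>j \<ge> 1\<close>, position \<open>m - j\<close> is below
    \<open>m\<close>, so reduction modulo \<open>2 ^ m\<close> keeps this digit.\<close>
  have digit: "(i mod 2 ^ m) div 2 ^ (m - j) mod 2 = i div 2 ^ (m - j) mod 2"
    if "j \<in> {1..m}" for j
  proof -
    have "bit (take_bit m i) (m - j) = bit i (m - j)" using that by (auto simp: bit_take_bit_iff)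
    then show ?thesis by (simp add: bit_iff_odd take_bit_eq_mod mod_2_eq_odd)
  qed
  have "(\<Sum>j = 1..Suc m. 2 * real (i div 2 ^ (Suc m - j) mod 2) / 3 ^ j)
      = 2 * real (i div 2 ^ m mod 2) / 3 +
        (\<Sum>j = Suc 1..Suc m. 2 * real (i div 2 ^ (Suc m - j) mod 2) / 3 ^ j)"
    by (subst sum.atLeast_Suc_atMost) auto
  also have "(\<Sum>j = Suc 1..Suc m. 2 * real (i div 2 ^ (Suc m - j) mod 2) / 3 ^ j)
      = (\<Sum>j = 1..m. 2 * real (i div 2 ^ (m - j) mod 2) / 3 ^ Suc j)"
    by (subst sum.shift_bounds_cl_Suc_ivl) simp
  also have "\<dots> = (\<Sum>j = 1..m. 2 * real ((i mod 2 ^ m) div 2 ^ (m - j) mod 2) / 3 ^ j) / 3"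
    unfolding sum_divide_distrib by (intro sum.cong refl) (simp add: digit)
  finally show ?thesis
    unfolding cantor_left_def by (simp add: field_simps)
qed

lemma cantor_left_bounds:
  assumes "i < 2 ^ m"
  shows "0 \<le> cantor_left (Suc m) (Suc i)" "cantor_left (Suc m) (Suc i) + 1 / 3 ^ Suc m \<le> 1"
proof -
  have "0 \<le> cantor_left (Suc m) (Suc i) \<and> cantor_left (Suc m) (Suc i) + 1 / 3 ^ Suc m \<le> 1"
    using assms
  proof (induction m arbitrary: i)
    case 0
    then show ?case by (simp add: cantor_left_def)
  next
    case (Suc m)
    have "i div 2 ^ m mod 2 \<le> 1" by simp
    then have "real (i div 2 ^ m mod 2) \<le> 1" by linarith
    moreover have "1 / 3 ^ Suc (Suc m) = (1 / 3 ^ Suc m) / (3::real)" by simp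
    ultimately show ?case
      using Suc.IH[of "i mod 2 ^ m"] unfolding cantor_left_Suc by (auto simp del: power_Suc)
  qed
  then show "0 \<le> cantor_left (Suc m) (Suc i)" "cantor_left (Suc m) (Suc i) + 1 / 3 ^ Suc m \<le> 1"
    by auto
qed

text \<open>Zooming into the outer third that contains \<open>t\<close> lowers the level by one;
  gaps beyond the first level avoid the middle third.\<close>

lemma cantor_gap_Suc:
  assumes "i < 2 ^ Suc m" "t \<in> cantor_gap (Suc (Suc m)) (Suc i)"
  shows "3 * t - 2 * real (i div 2 ^ m) \<in> cantor_gap (Suc m) (Suc (i mod 2 ^ m))"
    "i div 2 ^ m = 0 \<and> t < 1 / 3 \<or> i div 2 ^ m = 1 \<and> t > 2 / 3"
proof -
  have d: "i div 2 ^ m < 2" using assms(1) by (simp add: less_mult_imp_div_less mult.commute)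
  have eq: "1 / 3 ^ Suc (Suc m) = (1 / 3 ^ Suc m) / (3::real)" by simp
  show *: "3 * t - 2 * real (i div 2 ^ m) \<in> cantor_gap (Suc m) (Suc (i mod 2 ^ m))"
    using assms(2) d unfolding cantor_gap_def cantor_left_Suc eq by (auto simp del: power_Suc)
  have "i mod 2 ^ m < 2 ^ m" by simp
  from cantor_left_bounds[OF this] * 
  have "0 < 3 * t - 2 * real (i div 2 ^ m)" "3 * t - 2 * real (i div 2 ^ m) < 1"
    unfolding cantor_gap_def by auto
  moreover have "i div 2 ^ m = 0 \<or> i div 2 ^ m = 1" using d by linarith
  ultimately show "i div 2 ^ m = 0 \<and> t < 1 / 3 \<or> i div 2 ^ m = 1 \<and> t > 2 / 3" by auto
qed

text \<open>The first gap is the middle third, which deeper gaps avoid. Two deeper gaps with a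
  common point lie in the same outer third, and zooming into it gives the induction step.\<close>

lemma cantor_gap_disjoint:
  assumes "i < 2 ^ m" "i' < 2 ^ m'"
    "t \<in> cantor_gap (Suc m) (Suc i)" "t \<in> cantor_gap (Suc m') (Suc i')"
  shows "m = m' \<and> i = i'"
  using assms
proof (induction m arbitrary: m' i i' t)
  case 0
  then have "1 / 3 < t" "t < 2 / 3" by (auto simp: cantor_gap_def cantor_left_def)
  with 0 show ?case using cantor_gap_Suc(2)[of i' _ t] by (cases m') auto
next
  case (Suc m)
  show ?case
  proof (cases m')
    case 0
    then have "1 / 3 < t" "t < 2 / 3"
      using Suc.prems(2,4) by (simp_all add: cantor_gap_def cantor_left_def)
    then show ?thesis using cantor_gap_Suc(2)[OF Suc.prems(1,3)] by auto
  next
    case (Suc l)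
    note i = cantor_gap_Suc[OF Suc.prems(1,3)]
    note i' = cantor_gap_Suc[OF Suc.prems(2,4)[unfolded Suc]]
    have "l = m \<and> i mod 2 ^ m = i' mod 2 ^ l"
      using Suc.IH[OF _ _ i(1), of "i' mod 2 ^ l" l] i(2) i'(1,2) by auto
    moreover have "i div 2 ^ m = i' div 2 ^ l" using i(2) i'(2) by auto
    ultimately show ?thesis using Suc by (metis div_mult_mod_eq)
  qed
qed

lemma closure_cantor_gap:
  "closure (cantor_gap n k) = {cantor_left n k .. cantor_left n k + 1 / 3 ^ n}"
  unfolding cantor_gap_def by (rule closure_greaterThanLessThan) simp

section \<open>The Hawaiian earring and the Cantor product\<close>

lemma hloop_eq_0_iff:
  assumes "n \<ge> 1" "s \<in> {0..1}"
  shows "hloop n s = 0 \<longleftrightarrow> s \<in> {0, 1}"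
proof
  assume "hloop n s = 0"
  then have "exp (2 * pi * \<i> * complex_of_real s) = 1" using assms(1) by (simp add: hloop_def)
  then obtain k :: int where "2 * pi * s = of_int (2 * k) * pi"
    unfolding exp_eq_1 by auto
  then have "s = of_int k" by simp
  then show "s \<in> {0, 1}" using assms(2) by auto
next
  assume "s \<in> {0, 1}"
  then show "hloop n s = 0" by (auto simp: hloop_def exp_eq_1)
qed

text \<open>The circle equation \<open>n * |z|^2 = 2 * Re z\<close> determines \<open>n\<close> when
  \<open>z\<close> is nonzero. The parameters then differ by an integer and both lie strictly
  between 0 and 1.\<close>

lemma hloop_inject:
  assumes n: "n \<ge> 1" and n': "n' \<ge> 1" and s: "s \<in> {0..1}" and s': "s' \<in> {0..1}"
    and eq: "hloop n s = hloop n' s'" and nz: "hloop n s \<noteq> 0"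
  shows "n = n' \<and> s = s'"
proof -
  define z where "z = hloop n s"
  have radius: "real m * (cmod z)\<^sup>2 = 2 * Re z" if "m \<ge> 1" "hloop m u = z" for m u
  proof -
    have "1 - of_nat m * z = exp (2 * pi * \<i> * complex_of_real u)"
      using that by (auto simp: hloop_def)
    then have "cmod (1 - of_nat m * z) = 1" by simp
    then have "(cmod (1 - of_nat m * z))\<^sup>2 = 1" by simp
    then have "(1 - real m * Re z)\<^sup>2 + (real m * Im z)\<^sup>2 = 1" by (simp add: cmod_power2)
    then have "real m * (real m * ((Re z)\<^sup>2 + (Im z)\<^sup>2)) = real m * (2 * Re z)"
      by (simp add: power2_eq_square algebra_simps)
    then show ?thesis using that(1) by (simp add: cmod_power2)
  qed
  have "real n * (cmod z)\<^sup>2 = real n' * (cmod z)\<^sup>2"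
    using radius[OF n] radius[OF n'] eq by (simp add: z_def)
  then have nn: "n = n'" using nz by (simp add: z_def)
  then have "exp (2 * pi * \<i> * complex_of_real s) = exp (2 * pi * \<i> * complex_of_real s')"
    using eq n by (simp add: hloop_def)
  then obtain k :: int where
    "2 * pi * \<i> * complex_of_real s = 2 * pi * \<i> * complex_of_real s' + (of_int (2 * k) * pi) * \<i>"
    unfolding exp_eq by auto
  then have "Im (2 * pi * \<i> * complex_of_real s) =
      Im (2 * pi * \<i> * complex_of_real s' + (of_int (2 * k) * pi) * \<i>)"
    by simp
  then have "pi * s = pi * (s' + of_int k)" by (simp add: algebra_simps)
  then have k: "s = s' + of_int k" by simp
  have "0 < s \<and> s < 1" "0 < s' \<and> s' < 1"
    using hloop_eq_0_iff[OF n s] hloop_eq_0_iff[OF n' s'] nz eq s s' by auto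
  then have "- 1 < real_of_int k" "real_of_int k < 1" using k by auto
  then have "k = 0" by linarith
  then show ?thesis using nn k by simp
qed

text \<open>By \<open>hloop_inject\<close> the choice in \<open>induced_map\<close> is forced away
  from the base point; at the base point every loop has the value \<open>x\<close>.\<close>

lemma induced_map_hloop:
  assumes "\<And>n. based_loop x (\<alpha> n)" and n: "n \<ge> 1" and s: "s \<in> {0..1}"
  shows "induced_map x \<alpha> (hloop n s) = \<alpha> (n - 1) s"
proof (cases "hloop n s = 0")
  case True
  then show ?thesis
    using hloop_eq_0_iff[OF n s] based_loop_01[OF assms(1)] by (simp add: induced_map_def)
next
  case False
  have "hloop n s \<in> hawaiian" using n s unfolding hawaiian_def path_image_def by blast
  moreover have "(SOME (m, t). 1 \<le> m \<and> t \<in> {0..1} \<and> hloop m t = hloop n s) = (n, s)"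
    using n s hloop_inject[OF _ n _ s] False by (intro some_equality) fastforce+
  ultimately show ?thesis using False by (simp add: induced_map_def)
qed

lemma gap_indexE:
  assumes "gap_index n k"
  obtains m i where "n = Suc m" "k = Suc i" "i < 2 ^ m"
proof (rule that[of "n - 1" "k - 1"])
  show "k - 1 < 2 ^ (n - 1)" using assms unfolding gap_index_def by linarith
qed (use assms in \<open>auto simp: gap_index_def\<close>)

lemma prod_tau_in_gap:
  assumes \<alpha>: "\<And>n. based_loop x (\<alpha> n)" and i: "i < 2 ^ m" and t: "t \<in> cantor_gap (Suc m) (Suc i)"
  shows "prod_tau x \<alpha> t = \<alpha> (2 ^ m + i - 1) ((t - cantor_left (Suc m) (Suc i)) * 3 ^ Suc m)"
proof -
  let ?P = "\<lambda>n k. gap_index n k \<and> t \<in> closure (cantor_gap n k)"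
  have P: "?P (Suc m) (Suc i)" using i t closure_subset by (auto simp: gap_index_def)
  have uniq: "n = Suc m \<and> k = Suc i" if Pnk: "?P n k" for n k
  proof -
    obtain l j where lj: "n = Suc l" "k = Suc j" "j < 2 ^ l"
      using Pnk by (auto elim: gap_indexE)
    \<comment> \<open>\<open>ell_tau\<close> is defined through closed gaps, but an open gap meeting
      the closure of another one meets that gap itself.\<close>
    have "open (cantor_gap (Suc m) (Suc i))" by (simp add: cantor_gap_def)
    then have "cantor_gap (Suc m) (Suc i) \<inter> cantor_gap n k \<noteq> {}"
      using t Pnk open_Int_closure_eq_empty[of "cantor_gap (Suc m) (Suc i)" "cantor_gap n k"] by blast
    then show ?thesis using cantor_gap_disjoint[OF i lj(3)] lj by blast
  qed
  have "(SOME (n, k). ?P n k) = (Suc m, Suc i)"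
  proof (rule some_equality)
    show "case (Suc m, Suc i) of (n, k) \<Rightarrow> ?P n k" using P by simp
    show "nk = (Suc m, Suc i)" if "case nk of (n, k) \<Rightarrow> ?P n k" for nk
    proof -
      have "?P (fst nk) (snd nk)" using that by (simp only: case_prod_beta)
      then show ?thesis using uniq by (intro prod_eqI) simp_all
    qed
  qed
  then have "ell_tau t = hloop (2 ^ m + i) ((t - cantor_left (Suc m) (Suc i)) * 3 ^ Suc m)"
    using P unfolding ell_tau_def by auto
  moreover have "(t - cantor_left (Suc m) (Suc i)) * 3 ^ Suc m \<in> {0..1}"
    using t unfolding cantor_gap_def by (auto simp: field_simps)
  moreover have "1 \<le> 2 ^ m + i" by (simp add: trans_le_add1)
  ultimately show ?thesis
    unfolding prod_tau_def using induced_map_hloop[OF \<alpha>, of "2 ^ m + i"] by simp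
qed

text \<open>Such a \<open>t\<close> may still be an endpoint of a gap; whichever gap
  \<open>SOME\<close> returns, its loop is then evaluated at 0 or 1.\<close>

lemma prod_tau_outside_gaps:
  assumes t: "\<And>m i. i < 2 ^ m \<Longrightarrow> t \<notin> cantor_gap (Suc m) (Suc i)"
  shows "prod_tau x \<alpha> t = x"
proof -
  let ?P = "\<lambda>n k. gap_index n k \<and> t \<in> closure (cantor_gap n k)"
  have "ell_tau t = 0"
  proof (cases "\<exists>n k. ?P n k")
    case True
    obtain n k where nk: "(SOME (n, k). ?P n k) = (n, k)" by (rule prod.exhaust)
    have P: "?P n k"
      using someI_ex[of "\<lambda>(n, k). ?P n k"] True unfolding nk by auto
    then obtain l j where lj: "n = Suc l" "k = Suc j" "j < 2 ^ l"
      by (auto elim: gap_indexE)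
    have "t \<notin> cantor_gap n k" using t lj by blast
    then have "t = cantor_left n k \<or> t = cantor_left n k + 1 / 3 ^ n"
      using P unfolding closure_cantor_gap unfolding cantor_gap_def by auto
    then have s: "(t - cantor_left n k) * 3 ^ n \<in> {0, 1}" by auto
    have "1 \<le> 2 ^ (n - 1) + k - 1" using P unfolding gap_index_def
      by (simp add: Nat.le_diff_conv2 add_le_mono)
    then have "hloop (2 ^ (n - 1) + k - 1) ((t - cantor_left n k) * 3 ^ n) = 0"
      using hloop_eq_0_iff s by auto
    then show ?thesis using True nk unfolding ell_tau_def by auto
  next
    case False
    then show ?thesis unfolding ell_tau_def by (rule if_not_P)
  qed
  then show ?thesis by (simp add: prod_tau_def induced_map_def)
qed

text \<open>A single \<open>r\<close> is chosen before \<open>x\<close> and \<open>\<alpha>\<close>,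
  because it has to serve a sequence and its permutation alike.\<close>

lemma prod_tau_eq_loop_product:
  obtains r where "collapse_family r"
    "\<And>(x :: 'a::topological_space) \<alpha> t. (\<And>n. based_loop x (\<alpha> n)) \<Longrightarrow> t \<in> {0..1} \<Longrightarrow>
      prod_tau x \<alpha> t = loop_product x r \<alpha> t"
proof -
  \<comment> \<open>Numbers the gaps: \<open>N\<close> stands for the gap with
    \<open>n = m + 1\<close> and \<open>k = i + 1\<close>, whose circle is
    \<open>2 ^ m + i = Suc N\<close>. The shift by one occurs because sequences start at 0 and
    circles at 1.\<close>
  have "\<exists>m i. i < 2 ^ m \<and> Suc N = 2 ^ m + i" for N
  proof -
    obtain m where m: "2 ^ m \<le> Suc N" "Suc N < 2 ^ (m + 1)"
      using ex_power_ivl1[of 2 "Suc N"] by auto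
    then show ?thesis by (intro exI[of _ m] exI[of _ "Suc N - 2 ^ m"]) auto
  qed
  then obtain lev idx where li: "\<And>N. idx N < 2 ^ lev N" "\<And>N. Suc N = 2 ^ lev N + idx N"
    by metis
  have uniq: "lev N = m \<and> idx N = i" if "i < 2 ^ m" "Suc N = 2 ^ m + i" for N m i
  proof -
    have *: "\<not> l < l'" if "j < 2 ^ l" "2 ^ l + j = 2 ^ l' + j'" for l l' j j' :: nat
    proof
      assume "l < l'"
      then have "(2::nat) ^ Suc l \<le> 2 ^ l'" by (intro power_increasing) auto
      then show False using that by simp
    qed
    have "lev N = m" using *[OF li(1)] *[OF that(1)] li(2) that(2) by (metis linorder_neqE_nat)
    then show ?thesis using li(2)[of N] that(2) by simp
  qed
  define L where "L N = cantor_left (Suc (lev N)) (Suc (idx N))" for N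
  \<comment> \<open>The affine map of the gap onto the unit interval, clamped outside.\<close>
  define r where "r N t = max 0 (min 1 ((t - L N) * 3 ^ Suc (lev N)))" for N and t :: real
  have in_gap: "r N t \<in> {0, 1} \<longleftrightarrow> t \<notin> cantor_gap (Suc (lev N)) (Suc (idx N))" for N t
  proof -
    have "t \<in> cantor_gap (Suc (lev N)) (Suc (idx N)) \<longleftrightarrow>
        0 < (t - L N) * 3 ^ Suc (lev N) \<and> (t - L N) * 3 ^ Suc (lev N) < 1"
      unfolding cantor_gap_def L_def[symmetric]
      by (simp add: zero_less_mult_iff pos_less_divide_eq[symmetric] less_diff_eq diff_less_eq
          add.commute del: power_Suc)
    then show ?thesis unfolding r_def by (simp add: max_def min_def)
  qed
  have same: "M = N" if "r M t \<notin> {0, 1}" "r N t \<notin> {0, 1}" for M N t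
  proof -
    have "lev M = lev N \<and> idx M = idx N"
      using that cantor_gap_disjoint[OF li(1) li(1)] unfolding in_gap by blast
    then show ?thesis using li(2)[of M] li(2)[of N] by simp
  qed
  have r: "collapse_family r"
    unfolding collapse_family_def
  proof (intro conjI allI ballI)
    fix N
    show "continuous_on {0..1} (r N)" unfolding r_def by (intro continuous_intros)
    show "r N ` {0..1} \<subseteq> {0..1}" unfolding r_def by auto
    have "- L N * 3 ^ Suc (lev N) \<le> 0" using cantor_left_bounds(1)[OF li(1)[of N]]
      by (simp add: L_def)
    then show "r N 0 = 0" unfolding r_def by (simp del: power_Suc)
    have "1 / 3 ^ Suc (lev N) \<le> 1 - L N" using cantor_left_bounds(2)[OF li(1)[of N]]
      unfolding L_def by linarith
    then have "1 \<le> (1 - L N) * 3 ^ Suc (lev N)" by (simp add: divide_le_eq del: power_Suc)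
    then show "r N 1 = 1" unfolding r_def by linarith
  next
    fix t
    show "\<exists>n. \<forall>m. m \<noteq> n \<longrightarrow> r m t \<in> {0, 1}" using same by metis
  qed
  moreover have "prod_tau x \<alpha> t = loop_product x r \<alpha> t"
    if \<alpha>: "\<And>n. based_loop x (\<alpha> n)" and "t \<in> {0..1}" for x :: 'a and \<alpha> t
  proof (cases "\<exists>N. r N t \<notin> {0, 1}")
    case True
    then obtain N where N: "r N t \<notin> {0, 1}" by blast
    have "loop_product x r \<alpha> t = \<alpha> N (r N t)"
      unfolding loop_product_def
      by (rule glue_eq) (use same[OF _ N] based_loop_01[OF \<alpha>] in metis)
    moreover have "r N t = (t - L N) * 3 ^ Suc (lev N)"
      using N unfolding r_def by (auto simp: max_def min_def split: if_splits)
    moreover have "N = 2 ^ lev N + idx N - 1" using li(2)[of N] by simp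
    ultimately show ?thesis
      using prod_tau_in_gap[OF \<alpha> li(1), of t N] N unfolding in_gap L_def by simp
  next
    case False
    have "t \<notin> cantor_gap (Suc m) (Suc i)" if "i < 2 ^ m" for m i
    proof -
      have "Suc (2 ^ m + i - 1) = 2 ^ m + i" by simp
      then show ?thesis
        using uniq[OF that] False in_gap[of "2 ^ m + i - 1" t] by auto
    qed
    then have "prod_tau x \<alpha> t = x" by (rule prod_tau_outside_gaps)
    moreover have "\<alpha> n (r n t) = x" for n
      using False by (intro based_loop_01[OF \<alpha>]) blast
    then have "loop_product x r \<alpha> t = x" by (simp add: loop_product_def glue_def)
    ultimately show ?thesis by simp
  qed
  ultimately show ?thesis by (rule that)
qed

section \<open>Transfinite commutativity\<close>

text \<open>Both sides are products of the one sequence \<open>\<alpha>\<close>, over the gaps as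
  numbered by \<open>r\<close> and as renumbered by \<open>inv \<phi>\<close>, and each reduces to
  the same product of order type \<omega>.\<close>

proposition pre_delta_monoid_transfinitely_pi1_commutative:
  assumes M: "pre_delta_monoid mul e"
  shows "transfinitely_pi1_commutative e"
  unfolding transfinitely_pi1_commutative_def
proof (intro allI impI)
  fix \<alpha> :: "nat \<Rightarrow> real \<Rightarrow> 'a" and \<phi> :: "nat \<Rightarrow> nat"
  assume \<alpha>: "null_sequence e \<alpha>" and \<phi>: "bij \<phi>"
  obtain r where r: "collapse_family r"
    and prod: "\<And>(x::'a) \<alpha> t. (\<And>n. based_loop x (\<alpha> n)) \<Longrightarrow> t \<in> {0..1} \<Longrightarrow>
      prod_tau x \<alpha> t = loop_product x r \<alpha> t"
    using prod_tau_eq_loop_product by blast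
  note loop = null_sequenceD(1)[OF \<alpha>]
  note r' = collapse_family_permute[OF \<phi> r]
  have "homotopic_paths UNIV (prod_tau e \<alpha>) (loop_product e r \<alpha>)"
    using based_loop_loop_product[OF \<alpha> r] prod[OF loop]
    by (intro homotopic_paths_sym[OF homotopic_paths_eq]) (auto simp: based_loop_def)
  also have "homotopic_paths UNIV \<dots> (loop_product e dyadic_collapse \<alpha>)"
    by (rule homotopic_loop_product_dyadic[OF M \<alpha> r])
  also have "homotopic_paths UNIV \<dots> (loop_product e (\<lambda>n. r (inv \<phi> n)) \<alpha>)"
    by (rule homotopic_paths_sym[OF homotopic_loop_product_dyadic[OF M \<alpha> r']])
  also have "homotopic_paths UNIV \<dots> (prod_tau e (\<lambda>n. \<alpha> (\<phi> n)))"
    using based_loop_loop_product[OF \<alpha> r'] loop_product_permute[OF \<phi> r, of e \<alpha>]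
      prod[of e "\<lambda>n. \<alpha> (\<phi> n)"] loop
    by (intro homotopic_paths_eq) (auto simp: based_loop_def)
  finally show "homotopic_paths UNIV (prod_tau e \<alpha>) (prod_tau e (\<lambda>n. \<alpha> (\<phi> n)))" .
qed

theorem mainTheorem12:
  fixes mul :: "'a::topological_space \<Rightarrow> 'a \<Rightarrow> 'a" and e :: 'a
  assumes "pre_delta_group mul e"
    and "path_connected (UNIV :: 'a set)"
  shows "\<forall>x::'a. transfinitely_pi1_commutative x"
proof
  fix x :: 'a
  have M: "pre_delta_monoid mul e" using assms(1) by (simp add: pre_delta_group_def)
  obtain y where y: "mul x y = e" "mul y x = e"
    using assms(1) unfolding pre_delta_group_def by blast
  \<comment> \<open>The only inverse that occurs is the fixed element \<open>y\<close>, which enters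
    as a constant path.\<close>
  have "pre_delta_monoid (\<lambda>a b. mul a (mul y b)) x"
    unfolding pre_delta_monoid_def
  proof (intro conjI allI impI)
    fix a b c
    show "mul (mul a (mul y b)) (mul y c) = mul a (mul y (mul b (mul y c)))"
      by (simp add: pre_delta_monoidD(3)[OF M])
    show "mul x (mul y a) = a"
      by (simp add: pre_delta_monoidD(1)[OF M] y flip: pre_delta_monoidD(3)[OF M])
    show "mul a (mul y x) = a" by (simp add: pre_delta_monoidD(2)[OF M] y)
  next
    fix \<alpha> \<beta> :: "real \<Rightarrow> 'a" assume "path \<alpha>" "path \<beta>"
    moreover have "path (\<lambda>t::real. y)" by (simp add: path_def)
    ultimately show "path (\<lambda>t. mul (\<alpha> t) (mul y (\<beta> t)))"
      by (intro pre_delta_monoidD(4)[OF M])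
  qed
  then show "transfinitely_pi1_commutative x"
    by (rule pre_delta_monoid_transfinitely_pi1_commutative)
qed

end
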